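(* (Admissibility of $\multimap E$.) In the dagger lambda calculus the implication elimination rule is admissible: if $\Gamma\vdash_{S_1}t:A$ and $\Delta\vdash_{S_2}f:A^*\otimes B$ are derivable judgements (sharing no variables), where $A\multimap B := A^*\otimes B$, then $\Gamma,\Delta\vdash_{S_1\cup S_2}ft:B$ is derivable (using the sequent rules and soup reduction), where $ft$ denotes application.
   Context: The dagger lambda calculus. Types are generated from atomic types by $A^*$ and $A\otimes B$, with $(A^* )^*\equiv A$ and $(A\otimes B)^* := B^*\otimes A^*$; one atomic type $I$, with $I\equiv I^*$, acts as tensor unit. Terms are generated from typed variables and typed constants by $t_*$ and $t\otimes u$; if $t:A$ and $u:B$ then $t_*:A^*$ and $t\otimes u:A\otimes B$; $(t_* )_*\equiv t$ and $(t\otimes u)_* := u_*\otimes t_*$. For each type $A$ there is a constant $D_A:I$, with $D_I=1$ and $1=1_*$. A soup connection $t:u$ (also $t:_A u$) is an ordered pair of terms of the same type $A$, with the identification $t:u\equiv u_*:t_*$ and negation $(t:u)_* := t_*:u_*\equiv u:t$. A soup is a set of connections $\{v_1:v_2,\dots,v_{m-1}:v_m\}$; $S_*$ negates each connection. A typing judgement (sequent) has the form $t_1:A_1,\dots,t_n:A_n\vdash_S t:B$ with $S$ a soup ($\vdash$ means empty soup). A variable is bound if it occurs twice in the judgement (anywhere, including the soup); a term is bound (captured) if it contains no constants and all its variables are bound. $\alpha$-renaming replaces all occurrences of a bound variable by a constant-free term of the same type made of variables not occurring in the judgement, or replaces both occurrences of a bound term occurring twice by a fresh variable of the same type; $\alpha$-equivalence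 is its reflexive symmetric transitive closure. For $\Delta=t_1:T_1,\dots,t_n:T_n$, $\bigotimes\Delta$ is $((t_1\otimes t_2)\otimes\dots)\otimes t_n:((T_1\otimes T_2)\otimes\dots)\otimes T_n$. Judgements are derived by the following rules. Id: $x:A\vdash x:A$. Negation: from $a:A\vdash_S b:B$ infer $a_*:A^*\vdash_{S_*}b_*:B^*$. Cut: from $\Gamma\vdash_{S_1}a:A$ and $a':A,\Delta\vdash_{S_2}b:B$ infer $\Gamma,\Delta\vdash_{S_1\cup S_2\cup\{a:a'\}}b:B$. $\otimes R$: from $\Gamma\vdash_{S_1}a:A$ and $\Delta\vdash_{S_2}b:B$ infer $\Gamma,\bigotimes\Delta\vdash_{S_1\cup S_2}a\otimes b:A\otimes B$. Curry (both directions): $a:A,\Gamma\vdash_S b:B$ iff $\Gamma\vdash_S a_*\otimes b:A^*\otimes B$. $\otimes L$ (both directions): $\Gamma,a:A,b:B\vdash_S c:C$ iff $\Gamma,a\otimes b:A\otimes B\vdash_S c:C$. Exchange: adjacent left-hand terms may be swapped. Unit rules (both directions): $\Gamma\vdash_{S\cup\{i_*:1\}}b:B$ iff $i:I,\Gamma\vdash_S b:B$; and $\Gamma\vdash_{S\cup\{i_*:1\}}b:B$ iff $\Gamma,i:I\vdash_S b:B$. The premises of Cut and $\otimes R$ must share no variables ($\alpha$-rename first if needed), so every variable in a derivable judgement occurs exactly twice (linearity). Constants are introduced by $\vdash 1:I$ and, for a constant $f:A^*\otimes B$, by $a:A\vdash_{\{f:a_*\otimes b\}}b:B$. Soup reduction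 extends $\alpha$-equivalence by four rules. Bifunctoriality: $S\cup\{a\otimes b:c\otimes d\}\to S\cup\{a:c,b:d\}$. Trace: $S\cup\{x:_A x\}\to S\cup\{D_A:1\}$ ($x$ a variable). Cancellation: $S\cup\{1:1\}\to S$. Consumption: $\Gamma\vdash_{S\cup\{t:u\}}b:B\to(\Gamma\vdash_S b:B)[t/u]$ if $u$ contains no constants, or $\to(\Gamma\vdash_S b:B)[u/t]$ if $t$ contains no constants; here $[t/u]$ substitutes $t$ for $u$ throughout the whole judgement (including the soup), and the term substituted for must be one that was captured in the judgement. Application. For $t:A$ and $f:A^*\otimes B$, the application $ft$ is shorthand for a (fresh) variable $x:B$ together with a soup connection: $\Gamma\vdash_S ft:B$ means $\Gamma\vdash_{S\cup\{f:t_*\otimes x\}}x:B$. *)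

theory Defs
  imports Main
begin

text \<open>
  Types, terms and soup connections are taken modulo the identifications of the calculus.
  For types and terms these are realised by normal forms: the involution is pushed down to the
  leaves, so that \<open>(A\<^sup>*)\<^sup>* \<equiv> A\<close> and \<open>(A \<otimes> B)\<^sup>* \<equiv> B\<^sup>* \<otimes> A\<^sup>*\<close> are equalities.
  \<open>Unit\<close> is the atomic type \<open>I \<equiv> I\<^sup>*\<close>; it is not a strict unit for the tensor.
\<close>

datatype 'a ty = Unit | Atom 'a | AtomStar 'a | TTensor "'a ty" "'a ty" (infixl "\<otimes>\<^sub>T" 75)

primrec star_ty :: "'a ty \<Rightarrow> 'a ty" where
  "star_ty Unit = Unit"
| "star_ty (Atom p) = AtomStar p"
| "star_ty (AtomStar p) = Atom p"
| "star_ty (A \<otimes>\<^sub>T B) = star_ty B \<otimes>\<^sub>T star_ty A"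

abbreviation lolli :: "'a ty \<Rightarrow> 'a ty \<Rightarrow> 'a ty" (infixr "\<multimap>" 70) where
  "A \<multimap> B \<equiv> star_ty A \<otimes>\<^sub>T B"

lemma star_ty_star_ty [simp]: "star_ty (star_ty A) = A"
  by (induction A) auto

text \<open>
  Variables and constants carry their type, so every term \<open>t\<close> has exactly one type
  \<open>type_of t\<close> and the annotation in \<open>t : A\<close> amounts to \<open>type_of t = A\<close>. A variable is a pair of a number and a type.
  The constant \<open>1\<close> is kept apart from the other leaves because \<open>1 \<equiv> 1\<^sub>*\<close>. The leaf \<open>DimB A\<close> is only
  used through \<open>D\<close> below, hence never with \<open>A = Unit\<close>.
\<close>

datatype ('a, 'c) leaf = VarB nat "'a ty" | ConB 'c "'a ty" | DimB "'a ty"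

datatype ('a, 'c) tm =
    One
  | Pos "('a, 'c) leaf"
  | Neg "('a, 'c) leaf"
  | Tensor "('a, 'c) tm" "('a, 'c) tm" (infixl "\<otimes>" 75)

abbreviation Var :: "nat \<Rightarrow> 'a ty \<Rightarrow> ('a, 'c) tm" where
  "Var x A \<equiv> Pos (VarB x A)"

abbreviation Con :: "'c \<Rightarrow> 'a ty \<Rightarrow> ('a, 'c) tm" where
  "Con c A \<equiv> Pos (ConB c A)"

definition D :: "'a ty \<Rightarrow> ('a, 'c) tm" where
  "D A = (if A = Unit then One else Pos (DimB A))"

primrec star :: "('a, 'c) tm \<Rightarrow> ('a, 'c) tm" where
  "star One = One"
| "star (Pos k) = Neg k"
| "star (Neg k) = Pos k"
| "star (t \<otimes> u) = star u \<otimes> star t"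

primrec leaf_ty :: "('a, 'c) leaf \<Rightarrow> 'a ty" where
  "leaf_ty (VarB x A) = A"
| "leaf_ty (ConB c A) = A"
| "leaf_ty (DimB A) = Unit"

primrec type_of :: "('a, 'c) tm \<Rightarrow> 'a ty" where
  "type_of One = Unit"
| "type_of (Pos k) = leaf_ty k"
| "type_of (Neg k) = star_ty (leaf_ty k)"
| "type_of (t \<otimes> u) = type_of t \<otimes>\<^sub>T type_of u"

primrec leaf_vars :: "('a, 'c) leaf \<Rightarrow> (nat \<times> 'a ty) set" where
  "leaf_vars (VarB x A) = {(x, A)}"
| "leaf_vars (ConB c A) = {}"
| "leaf_vars (DimB A) = {}"

primrec vars :: "('a, 'c) tm \<Rightarrow> (nat \<times> 'a ty) set" where
  "vars One = {}"
| "vars (Pos k) = leaf_vars k"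
| "vars (Neg k) = leaf_vars k"
| "vars (t \<otimes> u) = vars t \<union> vars u"

primrec const_free :: "('a, 'c) tm \<Rightarrow> bool" where
  "const_free One = False"
| "const_free (Pos k) = (leaf_vars k \<noteq> {})"
| "const_free (Neg k) = (leaf_vars k \<noteq> {})"
| "const_free (t \<otimes> u) = (const_free t \<and> const_free u)"

lemma star_star [simp]: "star (star t) = t"
  by (induction t) auto

lemma star_eq_iff: "star t = u \<longleftrightarrow> t = star u"
  by auto

lemma eq_star_iff:
  "One = star u \<longleftrightarrow> u = One"
  "Pos k = star u \<longleftrightarrow> u = Neg k"
  "Neg k = star u \<longleftrightarrow> u = Pos k"
  "s \<otimes> s' = star u \<longleftrightarrow> u = star s' \<otimes> star s"
  by (metis star.simps star_star)+

lemma type_of_star [simp]: "type_of (star t) = star_ty (type_of t)"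
  by (induction t) auto

lemma vars_star [simp]: "vars (star t) = vars t"
  by (induction t) auto

lemma const_free_star [simp]: "const_free (star t) = const_free t"
  by (induction t) auto

text \<open>
  \<open>occ u s\<close> counts the occurrences of \<open>u\<close> as a subterm of \<open>s\<close>; since \<open>x\<^sub>*\<close> is an occurrence of \<open>x\<close>,
  occurrences of \<open>u\<^sub>*\<close> count as occurrences of \<open>u\<close>.
\<close>

primrec occ :: "('a, 'c) tm \<Rightarrow> ('a, 'c) tm \<Rightarrow> nat" where
  "occ u One = (if One = u \<or> One = star u then 1 else 0)"
| "occ u (Pos k) = (if Pos k = u \<or> Pos k = star u then 1 else 0)"
| "occ u (Neg k) = (if Neg k = u \<or> Neg k = star u then 1 else 0)"
| "occ u (s \<otimes> s') = (if s \<otimes> s' = u \<or> s \<otimes> s' = star u then 1 else occ u s + occ u s')"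

lemma occ_star [simp]: "occ u (star s) = occ u s"
  by (induction s) (auto simp: eq_star_iff)

text \<open>
  \<open>subst v u s\<close> is \<open>s[v/u]\<close>, which also puts \<open>v\<^sub>*\<close> for \<open>u\<^sub>*\<close>. For a self-dual \<open>u\<close>, such as \<open>1\<close> or
  \<open>x \<otimes> x\<^sub>*\<close>, this is ambiguous, and \<open>subst\<close> then does nothing. The rules below only substitute for terms
  that are captured and occur twice in the judgement (a bound variable, for instance); these are
  constant-free with pairwise distinct variables and hence not self-dual.
\<close>

definition subst_step :: "('a, 'c) tm \<Rightarrow> ('a, 'c) tm \<Rightarrow> ('a, 'c) tm \<Rightarrow> ('a, 'c) tm \<Rightarrow> ('a, 'c) tm" where
  "subst_step v u s r =
     (if star u = u then r else if s = u then v else if s = star u then star v else r)"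

primrec subst :: "('a, 'c) tm \<Rightarrow> ('a, 'c) tm \<Rightarrow> ('a, 'c) tm \<Rightarrow> ('a, 'c) tm" where
  "subst v u One = subst_step v u One One"
| "subst v u (Pos k) = subst_step v u (Pos k) (Pos k)"
| "subst v u (Neg k) = subst_step v u (Neg k) (Neg k)"
| "subst v u (s \<otimes> s') = subst_step v u (s \<otimes> s') (subst v u s \<otimes> subst v u s')"

lemma star_subst_step: "star (subst_step v u s r) = subst_step v u (star s) (star r)"
  by (auto simp: subst_step_def star_eq_iff)

lemma subst_star: "subst v u (star s) = star (subst v u s)"
  by (induction s) (simp_all add: star_subst_step)

text \<open>Soup connections: ordered pairs of terms with \<open>t : u \<equiv> u\<^sub>* : t\<^sub>*\<close>.\<close>

definition conn_eq :: "('a, 'c) tm \<times> ('a, 'c) tm \<Rightarrow> ('a, 'c) tm \<times> ('a, 'c) tm \<Rightarrow> bool" where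
  "conn_eq p q \<longleftrightarrow> q = p \<or> q = (star (snd p), star (fst p))"

quotient_type ('a, 'c) conn = "('a, 'c) tm \<times> ('a, 'c) tm" / conn_eq
  by (rule equivpI) (auto simp: reflp_def symp_def transp_def conn_eq_def)

lift_definition Conn :: "('a, 'c) tm \<Rightarrow> ('a, 'c) tm \<Rightarrow> ('a, 'c) conn" (infix "\<bowtie>" 60) is Pair .

lemma Conn_eq_iff: "t \<bowtie> u = t' \<bowtie> u' \<longleftrightarrow> t' = t \<and> u' = u \<or> t' = star u \<and> u' = star t"
  by transfer (auto simp: conn_eq_def)

lift_definition star_conn :: "('a, 'c) conn \<Rightarrow> ('a, 'c) conn" is
  "\<lambda>(t, u). (star t, star u)"
  by (auto simp: conn_eq_def)

lemma star_conn_Conn: "star_conn (t \<bowtie> u) = star t \<bowtie> star u" "star_conn (t \<bowtie> u) = u \<bowtie> t"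
  by (transfer, auto simp: conn_eq_def)+

lift_definition vars_conn :: "('a, 'c) conn \<Rightarrow> (nat \<times> 'a ty) set" is
  "\<lambda>(t, u). vars t \<union> vars u"
  by (auto simp: conn_eq_def)

lift_definition occ_conn :: "('a, 'c) tm \<Rightarrow> ('a, 'c) conn \<Rightarrow> nat" is
  "\<lambda>w (t, u). occ w t + occ w u"
  by (auto simp: conn_eq_def)

lift_definition subst_conn :: "('a, 'c) tm \<Rightarrow> ('a, 'c) tm \<Rightarrow> ('a, 'c) conn \<Rightarrow> ('a, 'c) conn" is
  "\<lambda>v w (t, u). (subst v w t, subst v w u)"
  by (auto simp: conn_eq_def subst_star)

datatype ('a, 'c) judgement =
  Judgement "('a, 'c) tm list" "('a, 'c) conn set" "('a, 'c) tm" ("(_ \<turnstile>[_] _)" [51, 0, 51] 50)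

primrec vars_j :: "('a, 'c) judgement \<Rightarrow> (nat \<times> 'a ty) set" where
  "vars_j (\<Gamma> \<turnstile>[S] b) = (\<Union>t\<in>set \<Gamma>. vars t) \<union> (\<Union>c\<in>S. vars_conn c) \<union> vars b"

primrec occ_j :: "('a, 'c) tm \<Rightarrow> ('a, 'c) judgement \<Rightarrow> nat" where
  "occ_j u (\<Gamma> \<turnstile>[S] b) = (\<Sum>t\<leftarrow>\<Gamma>. occ u t) + (\<Sum>c\<in>S. occ_conn u c) + occ u b"

primrec subst_j :: "('a, 'c) tm \<Rightarrow> ('a, 'c) tm \<Rightarrow> ('a, 'c) judgement \<Rightarrow> ('a, 'c) judgement" where
  "subst_j v u (\<Gamma> \<turnstile>[S] b) = (map (subst v u) \<Gamma> \<turnstile>[subst_conn v u ` S] subst v u b)"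

definition bound_var :: "nat \<times> 'a ty \<Rightarrow> ('a, 'c) judgement \<Rightarrow> bool" where
  "bound_var x J \<longleftrightarrow> occ_j (Var (fst x) (snd x)) J = 2"

definition captured :: "('a, 'c) tm \<Rightarrow> ('a, 'c) judgement \<Rightarrow> bool" where
  "captured t J \<longleftrightarrow> const_free t \<and> (\<forall>x\<in>vars t. bound_var x J)"

text \<open>
  The term replacing a bound variable must have pairwise distinct variables: otherwise these
  variables would occur more than twice afterwards. With this condition the two forms of renaming
  are inverse to each other.
\<close>

inductive alpha_step :: "('a, 'c) judgement \<Rightarrow> ('a, 'c) judgement \<Rightarrow> bool" where
  rename_var:
    "\<lbrakk>bound_var (x, A) J; const_free t; type_of t = A;
      \<forall>(y, B)\<in>vars t. occ (Var y B) t = 1; vars t \<inter> vars_j J = {}\<rbrakk>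
     \<Longrightarrow> alpha_step J (subst_j t (Var x A) J)"
| rename_term:
    "\<lbrakk>captured t J; occ_j t J = 2; (y, type_of t) \<notin> vars_j J\<rbrakk>
     \<Longrightarrow> alpha_step J (subst_j (Var y (type_of t)) t J)"

abbreviation alpha_eq :: "('a, 'c) judgement \<Rightarrow> ('a, 'c) judgement \<Rightarrow> bool" where
  "alpha_eq \<equiv> equivclp alpha_step"

text \<open>
  In \<open>S \<union> {t : u}\<close> on the left of a reduction, and in the premises of the unit rules, the displayed
  connection is not an element of \<open>S\<close>, so that it is really removed.
  In the consumption rules, the term substituted for must be captured and must occur in the
  remaining judgement. If it did not, the connection would be discarded without any substitution
  taking place; for example \<open>x : x\<close> could be deleted without leaving \<open>D\<^sub>A : 1\<close>.
\<close>

inductive red :: "('a, 'c) judgement \<Rightarrow> ('a, 'c) judgement \<Rightarrow> bool" where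
  alpha: "alpha_eq J J' \<Longrightarrow> red J J'"
| bifunctoriality:
    "(a \<otimes> b) \<bowtie> (c \<otimes> d) \<notin> S \<Longrightarrow> type_of a = type_of c \<Longrightarrow> type_of b = type_of d
     \<Longrightarrow>     red (\<Gamma> \<turnstile>[S \<union> {(a \<otimes> b) \<bowtie> (c \<otimes> d)}] e) (\<Gamma> \<turnstile>[S \<union> {a \<bowtie> c, b \<bowtie> d}] e)"
| trace:
    "Var x A \<bowtie> Var x A \<notin> S \<Longrightarrow>
     red (\<Gamma> \<turnstile>[S \<union> {Var x A \<bowtie> Var x A}] e) (\<Gamma> \<turnstile>[S \<union> {D A \<bowtie> One}] e)"
| cancellation:
    "One \<bowtie> One \<notin> S \<Longrightarrow> red (\<Gamma> \<turnstile>[S \<union> {One \<bowtie> One}] e) (\<Gamma> \<turnstile>[S] e)"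
| consumption_right:
    "\<lbrakk>t \<bowtie> u \<notin> S; type_of t = type_of u; captured u (\<Gamma> \<turnstile>[S \<union> {t \<bowtie> u}] e);
      occ_j u (\<Gamma> \<turnstile>[S] e) \<noteq> 0\<rbrakk> \<Longrightarrow>
     red (\<Gamma> \<turnstile>[S \<union> {t \<bowtie> u}] e) (subst_j t u (\<Gamma> \<turnstile>[S] e))"
| consumption_left:
    "\<lbrakk>t \<bowtie> u \<notin> S; type_of t = type_of u; captured t (\<Gamma> \<turnstile>[S \<union> {t \<bowtie> u}] e);
      occ_j t (\<Gamma> \<turnstile>[S] e) \<noteq> 0\<rbrakk> \<Longrightarrow>
     red (\<Gamma> \<turnstile>[S \<union> {t \<bowtie> u}] e) (subst_j u t (\<Gamma> \<turnstile>[S] e))"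

text \<open>
  \<open>big_tensor \<Delta>\<close> is the list consisting of the single term \<open>((t\<^sub>1 \<otimes> t\<^sub>2) \<otimes> \<dots>) \<otimes> t\<^sub>n\<close>; an empty context
  contributes nothing.
\<close>

fun big_tensor :: "('a, 'c) tm list \<Rightarrow> ('a, 'c) tm list" where
  "big_tensor [] = []"
| "big_tensor (t # ts) = [foldl Tensor t ts]"

text \<open>
  \<open>\<Sigma>\<close> is the set of typed constants of the calculus (apart from \<open>1\<close> and the \<open>D\<^sub>A\<close>).
  The type side condition in \<open>cut\<close> is the requirement that a connection relates terms of the same type.
\<close>

inductive derivable :: "('c \<times> 'a ty) set \<Rightarrow> ('a, 'c) judgement \<Rightarrow> bool" for \<Sigma> where
  id: "derivable \<Sigma> ([Var x A] \<turnstile>[{}] Var x A)"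
| negation: "derivable \<Sigma> ([a] \<turnstile>[S] b) \<Longrightarrow> derivable \<Sigma> ([star a] \<turnstile>[star_conn ` S] star b)"
| cut:
    "\<lbrakk>derivable \<Sigma> (\<Gamma> \<turnstile>[S1] a); derivable \<Sigma> (a' # \<Delta> \<turnstile>[S2] b); type_of a = type_of a';
      vars_j (\<Gamma> \<turnstile>[S1] a) \<inter> vars_j (a' # \<Delta> \<turnstile>[S2] b) = {}\<rbrakk>
     \<Longrightarrow> derivable \<Sigma> (\<Gamma> @ \<Delta> \<turnstile>[S1 \<union> S2 \<union> {a \<bowtie> a'}] b)"
| tensorR:
    "\<lbrakk>derivable \<Sigma> (\<Gamma> \<turnstile>[S1] a); derivable \<Sigma> (\<Delta> \<turnstile>[S2] b);
      vars_j (\<Gamma> \<turnstile>[S1] a) \<inter> vars_j (\<Delta> \<turnstile>[S2] b) = {}\<rbrakk>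
     \<Longrightarrow> derivable \<Sigma> (\<Gamma> @ big_tensor \<Delta> \<turnstile>[S1 \<union> S2] a \<otimes> b)"
| curry: "derivable \<Sigma> (a # \<Gamma> \<turnstile>[S] b) \<Longrightarrow> derivable \<Sigma> (\<Gamma> \<turnstile>[S] star a \<otimes> b)"
| uncurry: "derivable \<Sigma> (\<Gamma> \<turnstile>[S] star a \<otimes> b) \<Longrightarrow> derivable \<Sigma> (a # \<Gamma> \<turnstile>[S] b)"
| tensorL: "derivable \<Sigma> (\<Gamma> @ [a, b] \<turnstile>[S] c) \<Longrightarrow> derivable \<Sigma> (\<Gamma> @ [a \<otimes> b] \<turnstile>[S] c)"
| untensorL: "derivable \<Sigma> (\<Gamma> @ [a \<otimes> b] \<turnstile>[S] c) \<Longrightarrow> derivable \<Sigma> (\<Gamma> @ [a, b] \<turnstile>[S] c)"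
| exchange:
    "derivable \<Sigma> (\<Gamma> @ [a, b] @ \<Delta> \<turnstile>[S] c) \<Longrightarrow> derivable \<Sigma> (\<Gamma> @ [b, a] @ \<Delta> \<turnstile>[S] c)"
| unit_left:
    "\<lbrakk>derivable \<Sigma> (\<Gamma> \<turnstile>[S \<union> {star i \<bowtie> One}] b); type_of i = Unit; star i \<bowtie> One \<notin> S\<rbrakk>
     \<Longrightarrow> derivable \<Sigma> (i # \<Gamma> \<turnstile>[S] b)"
| ununit_left:
    "\<lbrakk>derivable \<Sigma> (i # \<Gamma> \<turnstile>[S] b); type_of i = Unit\<rbrakk>
     \<Longrightarrow> derivable \<Sigma> (\<Gamma> \<turnstile>[S \<union> {star i \<bowtie> One}] b)"
| unit_right:
    "\<lbrakk>derivable \<Sigma> (\<Gamma> \<turnstile>[S \<union> {star i \<bowtie> One}] b); type_of i = Unit; star i \<bowtie> One \<notin> S\<rbrakk>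
     \<Longrightarrow> derivable \<Sigma> (\<Gamma> @ [i] \<turnstile>[S] b)"
| ununit_right:
    "\<lbrakk>derivable \<Sigma> (\<Gamma> @ [i] \<turnstile>[S] b); type_of i = Unit\<rbrakk>
     \<Longrightarrow> derivable \<Sigma> (\<Gamma> \<turnstile>[S \<union> {star i \<bowtie> One}] b)"
| one: "derivable \<Sigma> ([] \<turnstile>[{}] One)"
| const:
    "\<lbrakk>(f, A \<multimap> B) \<in> \<Sigma>; (a, A) \<noteq> (b, B)\<rbrakk>
     \<Longrightarrow> derivable \<Sigma> ([Var a A] \<turnstile>[{Con f (A \<multimap> B) \<bowtie> star (Var a A) \<otimes> Var b B}] Var b B)"
| reduction: "derivable \<Sigma> J \<Longrightarrow> red J J' \<Longrightarrow> derivable \<Sigma> J'"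

text \<open>
  \<open>application \<Gamma> S f t x B\<close> is the judgement abbreviated by \<open>\<Gamma> \<turnstile>\<^sub>S f t : B\<close>, with the variable \<open>x : B\<close> as
  its result; \<open>x\<close> has to be chosen fresh.
\<close>

definition application ::
  "('a, 'c) tm list \<Rightarrow> ('a, 'c) conn set \<Rightarrow> ('a, 'c) tm \<Rightarrow> ('a, 'c) tm \<Rightarrow> nat \<Rightarrow> 'a ty
   \<Rightarrow> ('a, 'c) judgement" where
  "application \<Gamma> S f t x B = (\<Gamma> \<turnstile>[S \<union> {f \<bowtie> star t \<otimes> Var x B}] Var x B)"

end

theory Submission
  imports Defs
begin

text \<open>
  Tensoring \<open>\<Gamma> \<turnstile> t : A\<close> with the axiom \<open>x : B \<turnstile> x : B\<close> gives \<open>\<Gamma>, x : B \<turnstile> t \<otimes> x : A \<otimes> B\<close>. As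
  \<open>t \<equiv> (t\<^sub>*)\<^sub>*\<close>, uncurrying moves \<open>t\<^sub>*\<close> to the left, where it is tensored with \<open>x\<close>, so that
  \<open>t\<^sub>* \<otimes> x : A \<multimap> B, \<Gamma> \<turnstile> x : B\<close>. A cut of \<open>\<Delta> \<turnstile> f\<close> against \<open>t\<^sub>* \<otimes> x\<close> creates exactly the connection
  that the application \<open>f t\<close> stands for. No soup reduction is needed.
\<close>

lemma derivable_move:
  "derivable \<Sigma> (\<Xi> @ a # \<Delta> @ \<Theta> \<turnstile>[S] c) \<Longrightarrow> derivable \<Sigma> (\<Xi> @ \<Delta> @ a # \<Theta> \<turnstile>[S] c)"
proof (induction \<Delta> arbitrary: \<Xi>)
  case (Cons d \<Delta>)
  then have "derivable \<Sigma> (\<Xi> @ [d, a] @ \<Delta> @ \<Theta> \<turnstile>[S] c)"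
    using exchange[of \<Sigma> \<Xi> a d] by simp
  then show ?case
    using Cons.IH[of "\<Xi> @ [d]"] by simp
qed simp

text \<open>The terms of \<open>\<Gamma>\<close> pass \<open>\<Delta>\<close> one at a time, the
  last one first.\<close>

lemma derivable_swap:
  "derivable \<Sigma> (\<Xi> @ \<Gamma> @ \<Delta> @ \<Theta> \<turnstile>[S] c) \<Longrightarrow> derivable \<Sigma> (\<Xi> @ \<Delta> @ \<Gamma> @ \<Theta> \<turnstile>[S] c)"
proof (induction \<Gamma> arbitrary: \<Xi>)
  case (Cons g \<Gamma>)
  then have "derivable \<Sigma> (\<Xi> @ g # \<Delta> @ \<Gamma> @ \<Theta> \<turnstile>[S] c)"
    using Cons.IH[of "\<Xi> @ [g]"] by simp
  then show ?case
    using derivable_move[of \<Sigma> \<Xi> g \<Delta>] by simp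
qed simp

lemma derivable_swap_append:
  "derivable \<Sigma> (\<Gamma> @ \<Delta> \<turnstile>[S] c) \<Longrightarrow> derivable \<Sigma> (\<Delta> @ \<Gamma> \<turnstile>[S] c)"
  using derivable_swap[of \<Sigma> "[]" \<Gamma> \<Delta> "[]"] by simp

lemma derivable_apply_context:
  assumes "derivable \<Sigma> (\<Gamma> \<turnstile>[S] t)" and "(x, B) \<notin> vars_j (\<Gamma> \<turnstile>[S] t)"
  shows "derivable \<Sigma> (star t \<otimes> Var x B # \<Gamma> \<turnstile>[S] Var x B)"
proof -
  \<comment> \<open>\<open>big_tensor\<close> fixes a one-term context; the double
    \<open>star\<close> fits \<open>uncurry\<close>.\<close>
  have "derivable \<Sigma> (\<Gamma> @ [Var x B] \<turnstile>[S] star (star t) \<otimes> Var x B)"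
    using tensorR[OF assms(1) derivable.id[of \<Sigma> x B]] assms(2) by simp
  then have "derivable \<Sigma> (star t # \<Gamma> @ [Var x B] \<turnstile>[S] Var x B)"
    by (rule uncurry)
  \<comment> \<open>\<open>tensorL\<close> acts only at the right end of a context,
    \<open>cut\<close> on its head.\<close>
  then have "derivable \<Sigma> (\<Gamma> @ [star t, Var x B] \<turnstile>[S] Var x B)"
    using derivable_move[of \<Sigma> "[]"] by simp
  then have "derivable \<Sigma> (\<Gamma> @ [star t \<otimes> Var x B] \<turnstile>[S] Var x B)"
    by (rule tensorL)
  then show ?thesis
    using derivable_swap_append[of \<Sigma> \<Gamma> "[star t \<otimes> Var x B]"] by simp
qed

theorem theorem2p1:
  fixes \<Sigma> :: "('c \<times> 'a ty) set"
    and \<Gamma> \<Delta> :: "('a, 'c) tm list"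
    and S1 S2 :: "('a, 'c) conn set"
    and t f :: "('a, 'c) tm"
    and A B :: "'a ty"
    and x :: nat
  assumes "derivable \<Sigma> (\<Gamma> \<turnstile>[S1] t)" and "type_of t = A"
    and "derivable \<Sigma> (\<Delta> \<turnstile>[S2] f)" and "type_of f = A \<multimap> B"
    and "vars_j (\<Gamma> \<turnstile>[S1] t) \<inter> vars_j (\<Delta> \<turnstile>[S2] f) = {}"
    and "(x, B) \<notin> vars_j (\<Gamma> \<turnstile>[S1] t) \<union> vars_j (\<Delta> \<turnstile>[S2] f)"
  shows "derivable \<Sigma> (application (\<Gamma> @ \<Delta>) (S1 \<union> S2) f t x B)"
proof -
  have "derivable \<Sigma> (star t \<otimes> Var x B # \<Gamma> \<turnstile>[S1] Var x B)"
    using assms by (intro derivable_apply_context) auto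
  moreover have "vars_j (\<Delta> \<turnstile>[S2] f) \<inter> vars_j (star t \<otimes> Var x B # \<Gamma> \<turnstile>[S1] Var x B) = {}"
    using assms(5,6) by auto
  \<comment> \<open>\<open>f\<close> is the left premise of \<open>cut\<close>, so
    \<open>\<Delta>\<close> comes first and is swapped back below.\<close>
  ultimately have
    "derivable \<Sigma> (\<Delta> @ \<Gamma> \<turnstile>[S2 \<union> S1 \<union> {f \<bowtie> star t \<otimes> Var x B}] Var x B)"
    using cut[OF assms(3)] assms(2,4) by simp
  then show ?thesis
    unfolding application_def by (subst Un_commute[of S1]) (rule derivable_swap_append)
qed

end
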